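(* Let $R$ be an associative ring with identity, let $M$ be a unital right $R$-module and let $S=\operatorname{End}_R(M)$. Suppose that $M$ is image-projective, that $M$ generates its kernels, and that the center $Z(S)$ is von Neumann regular. Then the following are equivalent: (1) $M$ is centrally morphic; (2) $M$ is centrally quasi-morphic; (3) $S$ is right centrally morphic.
   Context: All rings are associative with identity and modules are unital right modules; $S=\operatorname{End}_R(M)$ acts on $M$ on the left. $Z(T)$ denotes the center of a ring $T$. For a ring $T$ and $a\in T$, $\operatorname{r.ann}_T(a)=\{x\in T: ax=0\}$. $M$ is image-projective if for all $f,g\in S$, $\operatorname{im} f\subseteq \operatorname{im} g$ implies $f\in gS$. $M$ generates its kernels if for every $f\in S$, $\ker f=\sum\{\operatorname{im}\gamma : \gamma\in S,\ \operatorname{im}\gamma\subseteq\ker f\}$. $M$ is centrally quasi-morphic if for every $f\in S$ there exist $g,h\in Z(S)$ with $\operatorname{im} f=\ker g$ and $\ker f=\operatorname{im} h$. $M$ is centrally morphic if for every $f\in S$ there exists a single $g\in Z(S)$ with $\operatorname{im} f=\ker g$ and $\ker f=\operatorname{im} g$. A ring $T$ is right centrally morphic if for every $a\in T$ there exists $b\in Z(T)$ with $\operatorname{r.ann}_T(a)=bT$ and $aT=\operatorname{r.ann}_T(b)$. A ring $T$ is von Neumann regular if for every $z\in T$ there is $x\in T$ with $z=zxz$. *)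

theory Defs
  imports "HOL-Algebra.Algebra"
begin

text \<open>
  The library's \<open>module\<close> locale requires a commutative scalar ring acting on the left, so right
  modules over an arbitrary ring are introduced here. As for the library's \<open>module\<close> record, the
  fields \<open>mult\<close> and \<open>one\<close> inherited from \<open>ring\<close> carry no meaning; only the
  additive structure is used.
\<close>

record ('a, 'b) rmodule = "'b ring" +
  rsmult :: "['b, 'a] \<Rightarrow> 'b" (infixl "\<triangleleft>\<index>" 70)

locale right_module = R?: ring R + M?: abelian_group M
  for R :: "('a, 'm) ring_scheme" (structure) and M :: "('a, 'b, 'n) rmodule_scheme" (structure) +
  assumes rsmult_closed [simp, intro]:
      "\<lbrakk>x \<in> carrier M; a \<in> carrier R\<rbrakk> \<Longrightarrow> x \<triangleleft>\<^bsub>M\<^esub> a \<in> carrier M"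
    and rsmult_add_scalar:
      "\<lbrakk>x \<in> carrier M; a \<in> carrier R; b \<in> carrier R\<rbrakk> \<Longrightarrow>
        x \<triangleleft>\<^bsub>M\<^esub> (a \<oplus>\<^bsub>R\<^esub> b) = x \<triangleleft>\<^bsub>M\<^esub> a \<oplus>\<^bsub>M\<^esub> x \<triangleleft>\<^bsub>M\<^esub> b"
    and rsmult_add_vector:
      "\<lbrakk>x \<in> carrier M; y \<in> carrier M; a \<in> carrier R\<rbrakk> \<Longrightarrow>
        (x \<oplus>\<^bsub>M\<^esub> y) \<triangleleft>\<^bsub>M\<^esub> a = x \<triangleleft>\<^bsub>M\<^esub> a \<oplus>\<^bsub>M\<^esub> y \<triangleleft>\<^bsub>M\<^esub> a"
    and rsmult_assoc:
      "\<lbrakk>x \<in> carrier M; a \<in> carrier R; b \<in> carrier R\<rbrakk> \<Longrightarrow>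
        x \<triangleleft>\<^bsub>M\<^esub> (a \<otimes>\<^bsub>R\<^esub> b) = (x \<triangleleft>\<^bsub>M\<^esub> a) \<triangleleft>\<^bsub>M\<^esub> b"
    and rsmult_one [simp]:
      "x \<in> carrier M \<Longrightarrow> x \<triangleleft>\<^bsub>M\<^esub> \<one>\<^bsub>R\<^esub> = x"

text \<open>
  Endomorphisms are extensional functions (undefined outside the carrier), so that equality in the
  endomorphism ring is equality of maps on \<open>carrier M\<close>. The product is
  \<open>f g = f \<circ> g\<close>, i.e. endomorphisms act on the left.
\<close>

definition endomorphisms ::
    "('a, 'm) ring_scheme \<Rightarrow> ('a, 'b, 'n) rmodule_scheme \<Rightarrow> ('b \<Rightarrow> 'b) set" where
  "endomorphisms R M = {f \<in> extensional (carrier M). f \<in> hom (add_monoid M) (add_monoid M) \<and>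
     (\<forall>x \<in> carrier M. \<forall>a \<in> carrier R. f (x \<triangleleft>\<^bsub>M\<^esub> a) = f x \<triangleleft>\<^bsub>M\<^esub> a)}"

definition End_ring ::
    "('a, 'm) ring_scheme \<Rightarrow> ('a, 'b, 'n) rmodule_scheme \<Rightarrow> ('b \<Rightarrow> 'b) ring" where
  "End_ring R M =
    \<lparr>carrier = endomorphisms R M,
     monoid.mult = (\<lambda>f g. compose (carrier M) f g),
     one = (\<lambda>x \<in> carrier M. x),
     ring.zero = (\<lambda>x \<in> carrier M. \<zero>\<^bsub>M\<^esub>),
     add = (\<lambda>f g. \<lambda>x \<in> carrier M. f x \<oplus>\<^bsub>M\<^esub> g x)\<rparr>"

abbreviation ker :: "('a, 'b, 'n) rmodule_scheme \<Rightarrow> ('b \<Rightarrow> 'b) \<Rightarrow> 'b set" where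
  "ker M f \<equiv> a_kernel M M f"

abbreviation im :: "('a, 'b, 'n) rmodule_scheme \<Rightarrow> ('b \<Rightarrow> 'b) \<Rightarrow> 'b set" where
  "im M f \<equiv> f ` carrier M"

text \<open>The sum of a possibly infinite family of submodules: all finite sums of their elements.\<close>

definition submodule_sum ::
    "('a, 'b, 'n) rmodule_scheme \<Rightarrow> ('i \<Rightarrow> 'b set) \<Rightarrow> 'i set \<Rightarrow> 'b set" where
  "submodule_sum M N I = {finsum M x F | x F. finite F \<and> F \<subseteq> I \<and> (\<forall>i \<in> F. x i \<in> N i)}"

definition center :: "('c, 'm) ring_scheme \<Rightarrow> 'c set" where
  "center T = {z \<in> carrier T. \<forall>x \<in> carrier T. z \<otimes>\<^bsub>T\<^esub> x = x \<otimes>\<^bsub>T\<^esub> z}"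

definition center_ring :: "('c, 'm) ring_scheme \<Rightarrow> ('c, 'm) ring_scheme" where
  "center_ring T = T\<lparr>carrier := center T\<rparr>"

definition von_Neumann_regular :: "('c, 'm) ring_scheme \<Rightarrow> bool" where
  "von_Neumann_regular T \<longleftrightarrow>
    (\<forall>z \<in> carrier T. \<exists>x \<in> carrier T. z = z \<otimes>\<^bsub>T\<^esub> x \<otimes>\<^bsub>T\<^esub> z)"

definition right_annihilator :: "('c, 'm) ring_scheme \<Rightarrow> 'c \<Rightarrow> 'c set" where
  "right_annihilator T a = {x \<in> carrier T. a \<otimes>\<^bsub>T\<^esub> x = \<zero>\<^bsub>T\<^esub>}"

text \<open>The right ideal \<open>aT\<close> is written as the library's \<open>a <#\<^bsub>T\<^esub> carrier T\<close>.\<close>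

definition right_centrally_morphic :: "('c, 'm) ring_scheme \<Rightarrow> bool" where
  "right_centrally_morphic T \<longleftrightarrow>
    (\<forall>a \<in> carrier T. \<exists>b \<in> center T.
       right_annihilator T a = b <#\<^bsub>T\<^esub> carrier T \<and>
       a <#\<^bsub>T\<^esub> carrier T = right_annihilator T b)"

definition image_projective ::
    "('a, 'm) ring_scheme \<Rightarrow> ('a, 'b, 'n) rmodule_scheme \<Rightarrow> bool" where
  "image_projective R M \<longleftrightarrow>
    (\<forall>f \<in> carrier (End_ring R M). \<forall>g \<in> carrier (End_ring R M).
       im M f \<subseteq> im M g \<longrightarrow> f \<in> g <#\<^bsub>End_ring R M\<^esub> carrier (End_ring R M))"

definition generates_its_kernels ::
    "('a, 'm) ring_scheme \<Rightarrow> ('a, 'b, 'n) rmodule_scheme \<Rightarrow> bool" where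
  "generates_its_kernels R M \<longleftrightarrow>
    (\<forall>f \<in> carrier (End_ring R M).
       ker M f = submodule_sum M (im M) {\<gamma> \<in> carrier (End_ring R M). im M \<gamma> \<subseteq> ker M f})"

definition centrally_quasi_morphic ::
    "('a, 'm) ring_scheme \<Rightarrow> ('a, 'b, 'n) rmodule_scheme \<Rightarrow> bool" where
  "centrally_quasi_morphic R M \<longleftrightarrow>
    (\<forall>f \<in> carrier (End_ring R M). \<exists>g \<in> center (End_ring R M). \<exists>h \<in> center (End_ring R M).
       im M f = ker M g \<and> ker M f = im M h)"

definition centrally_morphic ::
    "('a, 'm) ring_scheme \<Rightarrow> ('a, 'b, 'n) rmodule_scheme \<Rightarrow> bool" where
  "centrally_morphic R M \<longleftrightarrow>
    (\<forall>f \<in> carrier (End_ring R M). \<exists>g \<in> center (End_ring R M).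
       im M f = ker M g \<and> ker M f = im M g)"

lemma endomorphisms_iff:
  "f \<in> endomorphisms R M \<longleftrightarrow>
     f \<in> extensional (carrier M) \<and> (\<forall>x \<in> carrier M. f x \<in> carrier M) \<and>
     (\<forall>x \<in> carrier M. \<forall>y \<in> carrier M. f (x \<oplus>\<^bsub>M\<^esub> y) = f x \<oplus>\<^bsub>M\<^esub> f y) \<and>
     (\<forall>x \<in> carrier M. \<forall>a \<in> carrier R. f (x \<triangleleft>\<^bsub>M\<^esub> a) = f x \<triangleleft>\<^bsub>M\<^esub> a)"
  by (auto simp: endomorphisms_def hom_def Pi_def)

lemma (in right_module) zero_rsmult [simp]:
  assumes "a \<in> carrier R" shows "\<zero>\<^bsub>M\<^esub> \<triangleleft>\<^bsub>M\<^esub> a = \<zero>\<^bsub>M\<^esub>"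
  using rsmult_add_vector[OF M.zero_closed M.zero_closed assms] assms
  by (metis M.add.l_cancel_one M.l_zero M.zero_closed rsmult_closed)

lemma (in right_module) ring_End_ring: "ring (End_ring R M)"
proof (rule ringI)
  have neg: "(\<ominus>\<^bsub>M\<^esub> x) \<triangleleft>\<^bsub>M\<^esub> a = \<ominus>\<^bsub>M\<^esub> (x \<triangleleft>\<^bsub>M\<^esub> a)"
    if "x \<in> carrier M" "a \<in> carrier R" for x a
  proof (rule M.minus_equality[symmetric])
    show "(\<ominus>\<^bsub>M\<^esub> x) \<triangleleft>\<^bsub>M\<^esub> a \<oplus>\<^bsub>M\<^esub> x \<triangleleft>\<^bsub>M\<^esub> a = \<zero>\<^bsub>M\<^esub>"
      using that rsmult_add_vector[of "\<ominus>\<^bsub>M\<^esub> x" x a] by (simp add: M.l_neg)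
  qed (use that in auto)
  show "abelian_group (End_ring R M)"
  proof (rule abelian_groupI)
    fix f assume f: "f \<in> carrier (End_ring R M)"
    show "\<exists>g \<in> carrier (End_ring R M). g \<oplus>\<^bsub>End_ring R M\<^esub> f = \<zero>\<^bsub>End_ring R M\<^esub>"
      using f by (intro bexI[of _ "\<lambda>x \<in> carrier M. \<ominus>\<^bsub>M\<^esub> f x"])
        (auto simp: End_ring_def endomorphisms_iff M.l_neg neg M.minus_add cong: restrict_cong)
  next
    fix f assume f: "f \<in> carrier (End_ring R M)"
    show "\<zero>\<^bsub>End_ring R M\<^esub> \<oplus>\<^bsub>End_ring R M\<^esub> f = f"
      using f by (auto simp: End_ring_def endomorphisms_iff intro!: extensionalityI[of _ "carrier M"])
  next
    fix f g assume "f \<in> carrier (End_ring R M)" "g \<in> carrier (End_ring R M)"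
    then show "f \<oplus>\<^bsub>End_ring R M\<^esub> g \<in> carrier (End_ring R M)"
      by (simp add: End_ring_def endomorphisms_iff M.a_ac rsmult_add_vector)
  next
    show "\<zero>\<^bsub>End_ring R M\<^esub> \<in> carrier (End_ring R M)"
      by (simp add: End_ring_def endomorphisms_iff)
  next
    fix f g h assume "f \<in> carrier (End_ring R M)" "g \<in> carrier (End_ring R M)" "h \<in> carrier (End_ring R M)"
    then show "f \<oplus>\<^bsub>End_ring R M\<^esub> g \<oplus>\<^bsub>End_ring R M\<^esub> h = f \<oplus>\<^bsub>End_ring R M\<^esub> (g \<oplus>\<^bsub>End_ring R M\<^esub> h)"
      by (simp add: End_ring_def endomorphisms_iff M.a_assoc cong: restrict_cong)
  next
    fix f g assume "f \<in> carrier (End_ring R M)" "g \<in> carrier (End_ring R M)"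
    then show "f \<oplus>\<^bsub>End_ring R M\<^esub> g = g \<oplus>\<^bsub>End_ring R M\<^esub> f"
      by (simp add: End_ring_def endomorphisms_iff M.a_comm cong: restrict_cong)
  qed
  show "Group.monoid (End_ring R M)"
    by (rule monoidI)
      (auto simp: End_ring_def endomorphisms_iff compose_def intro!: extensionalityI[of _ "carrier M"])
next
  fix f g h assume "f \<in> carrier (End_ring R M)" "g \<in> carrier (End_ring R M)" "h \<in> carrier (End_ring R M)"
  then show "(f \<oplus>\<^bsub>End_ring R M\<^esub> g) \<otimes>\<^bsub>End_ring R M\<^esub> h = f \<otimes>\<^bsub>End_ring R M\<^esub> h \<oplus>\<^bsub>End_ring R M\<^esub> g \<otimes>\<^bsub>End_ring R M\<^esub> h"
    and "h \<otimes>\<^bsub>End_ring R M\<^esub> (f \<oplus>\<^bsub>End_ring R M\<^esub> g) = h \<otimes>\<^bsub>End_ring R M\<^esub> f \<oplus>\<^bsub>End_ring R M\<^esub> h \<otimes>\<^bsub>End_ring R M\<^esub> g"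
    by (auto simp: End_ring_def endomorphisms_iff compose_def restrict_def)
qed

lemma (in ring) subring_center: "subring (center R) R"
proof (rule subringI)
  show "center R \<subseteq> carrier R" "\<one> \<in> center R"
    by (auto simp: center_def)
next
  fix h assume "h \<in> center R"
  then have h: "h \<in> carrier R" "\<And>x. x \<in> carrier R \<Longrightarrow> h \<otimes> x = x \<otimes> h"
    unfolding center_def by blast+
  have "\<ominus> h \<otimes> x = x \<otimes> \<ominus> h" if "x \<in> carrier R" for x
    using that h(1) by (simp only: l_minus r_minus h(2)[OF that])
  then show "\<ominus> h \<in> center R"
    unfolding center_def using h(1) by blast
next
  fix h k assume "h \<in> center R" "k \<in> center R"
  then have hk: "h \<in> carrier R" "k \<in> carrier R"
    "\<And>x. x \<in> carrier R \<Longrightarrow> h \<otimes> x = x \<otimes> h" "\<And>x. x \<in> carrier R \<Longrightarrow> k \<otimes> x = x \<otimes> k"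
    unfolding center_def by blast+
  have "h \<otimes> k \<otimes> x = x \<otimes> (h \<otimes> k)" if x: "x \<in> carrier R" for x
  proof -
    have "h \<otimes> k \<otimes> x = h \<otimes> (x \<otimes> k)" by (simp only: m_assoc[OF hk(1,2) x] hk(4)[OF x])
    also have "\<dots> = x \<otimes> h \<otimes> k" by (simp only: m_assoc[OF hk(1) x hk(2), symmetric] hk(3)[OF x])
    finally show ?thesis by (simp only: m_assoc[OF x hk(1,2)])
  qed
  then show "h \<otimes> k \<in> center R"
    unfolding center_def using hk(1,2) by blast
  have "(h \<oplus> k) \<otimes> x = x \<otimes> (h \<oplus> k)" if x: "x \<in> carrier R" for x
    by (simp only: l_distr[OF hk(1,2) x] r_distr[OF hk(1,2) x] hk(3,4)[OF x])
  then show "h \<oplus> k \<in> center R"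
    unfolding center_def using hk(1,2) by blast
qed

lemma (in ring) ring_center_ring: "ring (center_ring R)"
  unfolding center_ring_def using subring_is_ring[OF subring_center] .

lemma (in right_module) submodule_sum_empty: "submodule_sum M N {} = {\<zero>\<^bsub>M\<^esub>}"
  by (auto simp: submodule_sum_def)

end

theory Submission
  imports Defs
begin

text \<open>
  Write \<open>S\<close> for the endomorphism ring. For endomorphisms, \<open>f g = 0\<close> says
  exactly that \<open>im g \<subseteq> ker f\<close>, so a right annihilator in \<open>S\<close> is the set of
  endomorphisms with image in a kernel. Image-projectivity gives the matching description of a
  principal right ideal: \<open>gS\<close> is the set of endomorphisms with image in \<open>im g\<close>.
  Hence \<open>ker f = im g\<close> implies \<open>r.ann(f) = gS\<close>. If \<open>M\<close> generates its
  kernels the converse holds as well, because \<open>ker f\<close> can then be recovered from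
  \<open>r.ann(f)\<close> as the sum of the images of its members. This is
  \<open>right_annihilator_eq_principal_iff\<close>, which translates each of the two equations in the
  definition of a centrally morphic module into the corresponding equation in \<open>S\<close>.

  Regularity of the center enters when the two central endomorphisms of a centrally
  quasi-morphic module have to be replaced by one. Suppose \<open>im f = ker g\<close> and
  \<open>ker f = im h\<close> with \<open>g\<close> and \<open>h\<close> central. Since
  \<open>g f = 0\<close> and \<open>f h = 0\<close>, commuting the factors gives
  \<open>im g \<subseteq> ker f = im h\<close>, while \<open>ker g = im f \<subseteq> ker h\<close>. If
  \<open>g = g x g\<close>, then \<open>1 - x g\<close> has image in \<open>ker g\<close>, so
  \<open>h\<close> annihilates it, whence \<open>h = h x g = g h x\<close> and
  \<open>im h \<subseteq> im g\<close>. Therefore \<open>ker f = im g\<close>, and \<open>g\<close> alone serves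
  both purposes.
\<close>

lemma center_commute:
  "z \<in> center T \<Longrightarrow> x \<in> carrier T \<Longrightarrow> z \<otimes>\<^bsub>T\<^esub> x = x \<otimes>\<^bsub>T\<^esub> z"
  by (simp add: center_def)

lemma center_closed: "z \<in> center T \<Longrightarrow> z \<in> carrier T"
  by (simp add: center_def)

lemma ker_iff: "x \<in> ker M f \<longleftrightarrow> x \<in> carrier M \<and> f x = \<zero>\<^bsub>M\<^esub>"
  by (auto simp: a_kernel_def')

lemma End_ring_apply_mult:
  "x \<in> carrier M \<Longrightarrow> (f \<otimes>\<^bsub>End_ring R M\<^esub> g) x = f (g x)"
  by (simp add: End_ring_def compose_def)

lemma End_ring_apply_closed:
  "f \<in> carrier (End_ring R M) \<Longrightarrow> x \<in> carrier M \<Longrightarrow> f x \<in> carrier M"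
  by (simp add: End_ring_def endomorphisms_iff)

lemma End_ring_apply_add:
  "f \<in> carrier (End_ring R M) \<Longrightarrow> x \<in> carrier M \<Longrightarrow> y \<in> carrier M \<Longrightarrow>
     f (x \<oplus>\<^bsub>M\<^esub> y) = f x \<oplus>\<^bsub>M\<^esub> f y"
  by (simp add: End_ring_def endomorphisms_iff)

lemma center_End_ring_apply:
  assumes "z \<in> center (End_ring R M)" "f \<in> carrier (End_ring R M)" "x \<in> carrier M"
  shows "z (f x) = f (z x)"
  unfolding End_ring_apply_mult[OF assms(3), where R = R, symmetric]
    center_commute[OF assms(1,2)] ..

lemma im_mult_subset:
  assumes "g \<in> carrier (End_ring R M)"
  shows "im M (f \<otimes>\<^bsub>End_ring R M\<^esub> g) \<subseteq> im M f"
  using End_ring_apply_closed[OF assms] by (auto simp: End_ring_apply_mult)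

context right_module
begin

abbreviation S where "S \<equiv> End_ring R M"

lemma End_ring_apply_zero:
  assumes f: "f \<in> carrier S" shows "f \<zero>\<^bsub>M\<^esub> = \<zero>\<^bsub>M\<^esub>"
proof -
  have "f \<zero>\<^bsub>M\<^esub> = f \<zero>\<^bsub>M\<^esub> \<oplus>\<^bsub>M\<^esub> f \<zero>\<^bsub>M\<^esub>"
    using End_ring_apply_add[OF f M.zero_closed M.zero_closed] by simp
  then show ?thesis
    using End_ring_apply_closed[OF f M.zero_closed] M.add.l_cancel_one' by blast
qed

lemma End_mult_closed: "f \<in> carrier S \<Longrightarrow> g \<in> carrier S \<Longrightarrow> f \<otimes>\<^bsub>S\<^esub> g \<in> carrier S"
  using ring_End_ring by (simp add: ring.ring_simprules)

lemma End_mult_eq_zero_iff: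
  assumes "f \<in> carrier S" "g \<in> carrier S"
  shows "f \<otimes>\<^bsub>S\<^esub> g = \<zero>\<^bsub>S\<^esub> \<longleftrightarrow> im M g \<subseteq> ker M f"
proof
  assume fg: "f \<otimes>\<^bsub>S\<^esub> g = \<zero>\<^bsub>S\<^esub>"
  have "f (g x) = \<zero>\<^bsub>M\<^esub>" if x: "x \<in> carrier M" for x
  proof -
    have "f (g x) = \<zero>\<^bsub>S\<^esub> x"
      unfolding fg[symmetric] by (rule End_ring_apply_mult[OF x, symmetric])
    then show ?thesis using x by (simp add: End_ring_def)
  qed
  then show "im M g \<subseteq> ker M f"
    using End_ring_apply_closed[OF assms(2)] by (simp add: image_subset_iff ker_iff)
next
  assume "im M g \<subseteq> ker M f"
  then have "f (g x) = \<zero>\<^bsub>M\<^esub>" if "x \<in> carrier M" for x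
    using that by (simp add: image_subset_iff ker_iff)
  then show "f \<otimes>\<^bsub>S\<^esub> g = \<zero>\<^bsub>S\<^esub>"
    by (simp add: End_ring_def compose_def cong: restrict_cong)
qed

lemma right_annihilator_End_ring:
  assumes "f \<in> carrier S"
  shows "right_annihilator S f = {\<gamma> \<in> carrier S. im M \<gamma> \<subseteq> ker M f}"
  using End_mult_eq_zero_iff[OF assms] by (auto simp: right_annihilator_def)

text \<open>Central elements commute, so the condition \<open>im f \<subseteq> ker g\<close>, i.e.
  \<open>g f = 0\<close>, is symmetric in \<open>f\<close> and \<open>g\<close>.\<close>

lemma central_im_subset_ker_swap:
  assumes "f \<in> carrier S" "g \<in> center S"
  shows "im M f \<subseteq> ker M g \<longleftrightarrow> im M g \<subseteq> ker M f"
  unfolding End_mult_eq_zero_iff[OF assms(1) center_closed[OF assms(2)], symmetric]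
    End_mult_eq_zero_iff[OF center_closed[OF assms(2)] assms(1), symmetric]
    center_commute[OF assms(2,1)] ..

lemma principal_right_ideal_End_ring:
  assumes "image_projective R M" "g \<in> carrier S"
  shows "g <#\<^bsub>S\<^esub> carrier S = {f \<in> carrier S. im M f \<subseteq> im M g}"
proof (intro equalityI subsetI)
  fix f assume "f \<in> g <#\<^bsub>S\<^esub> carrier S"
  then obtain s where s: "s \<in> carrier S" and f: "f = g \<otimes>\<^bsub>S\<^esub> s"
    by (auto simp: l_coset_def)
  show "f \<in> {f \<in> carrier S. im M f \<subseteq> im M g}"
    unfolding f using End_mult_closed[OF assms(2) s] im_mult_subset[OF s] by blast
next
  fix f assume "f \<in> {f \<in> carrier S. im M f \<subseteq> im M g}"
  then show "f \<in> g <#\<^bsub>S\<^esub> carrier S"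
    using assms by (auto simp: image_projective_def)
qed

lemma finsum_in_im:
  assumes g: "g \<in> carrier S" and "finite F" and "\<And>i. i \<in> F \<Longrightarrow> x i \<in> im M g"
  shows "finsum M x F \<in> im M g"
  using assms(2,3)
proof (induction F)
  case empty
  show ?case
    by (rule image_eqI[of _ g "\<zero>\<^bsub>M\<^esub>"]) (simp_all add: End_ring_apply_zero[OF g])
next
  case (insert i F)
  have im_closed: "im M g \<subseteq> carrier M"
    using End_ring_apply_closed[OF g] by blast
  obtain u where u: "u \<in> carrier M" "x i = g u"
    using insert.prems by blast
  obtain v where v: "v \<in> carrier M" "finsum M x F = g v"
    using insert.IH insert.prems by blast
  have "x i \<oplus>\<^bsub>M\<^esub> finsum M x F = g (u \<oplus>\<^bsub>M\<^esub> v)" "u \<oplus>\<^bsub>M\<^esub> v \<in> carrier M"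
    using u v End_ring_apply_add[OF g] by simp_all
  moreover have "finsum M x (insert i F) = x i \<oplus>\<^bsub>M\<^esub> finsum M x F"
    using insert.hyps insert.prems im_closed by (intro M.finsum_insert) auto
  ultimately show ?case by simp
qed

text \<open>An element of \<open>ker f\<close> is a finite sum of elements of images
  \<open>im \<gamma> \<subseteq> ker f\<close>, so an inclusion of \<open>ker f\<close> in another image can be tested on
  those \<open>im \<gamma>\<close>, that is, on the right annihilator of \<open>f\<close>.\<close>

lemma ker_subset_im:
  assumes "generates_its_kernels R M" "f \<in> carrier S" "g \<in> carrier S"
    and "\<And>\<gamma>. \<gamma> \<in> carrier S \<Longrightarrow> im M \<gamma> \<subseteq> ker M f \<Longrightarrow> im M \<gamma> \<subseteq> im M g"
  shows "ker M f \<subseteq> im M g"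
proof
  fix m assume "m \<in> ker M f"
  then have "m \<in> submodule_sum M (im M) {\<gamma> \<in> carrier S. im M \<gamma> \<subseteq> ker M f}"
    using assms(1,2) unfolding generates_its_kernels_def by blast
  then obtain x F where "m = finsum M x F" "finite F"
    and F: "F \<subseteq> {\<gamma> \<in> carrier S. im M \<gamma> \<subseteq> ker M f}" "\<forall>\<gamma> \<in> F. x \<gamma> \<in> im M \<gamma>"
    unfolding submodule_sum_def by auto
  moreover have "x \<gamma> \<in> im M g" if "\<gamma> \<in> F" for \<gamma>
    using that F assms(4) by blast
  ultimately show "m \<in> im M g"
    using finsum_in_im[OF assms(3)] by blast
qed

text \<open>Both sides of the ring equation are sets of endomorphisms cut out by where their images
  lie, namely in \<open>ker f\<close> and in \<open>im g\<close>. They therefore coincide as soon as these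
  submodules do. Conversely, applying the equality to \<open>g\<close> itself gives
  \<open>im g \<subseteq> ker f\<close>, and the other inclusion holds for every \<open>im \<gamma>\<close> inside
  \<open>ker f\<close>, hence for their sum.\<close>

lemma right_annihilator_eq_principal_iff:
  assumes "image_projective R M" "generates_its_kernels R M"
    and f: "f \<in> carrier S" and g: "g \<in> carrier S"
  shows "right_annihilator S f = g <#\<^bsub>S\<^esub> carrier S \<longleftrightarrow> ker M f = im M g"
proof
  assume ideals_eq: "right_annihilator S f = g <#\<^bsub>S\<^esub> carrier S"
  have same_images: "im M \<gamma> \<subseteq> ker M f \<longleftrightarrow> im M \<gamma> \<subseteq> im M g" if "\<gamma> \<in> carrier S" for \<gamma>
  proof -
    have "\<gamma> \<in> right_annihilator S f \<longleftrightarrow> \<gamma> \<in> g <#\<^bsub>S\<^esub> carrier S"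
      by (simp only: ideals_eq)
    then show ?thesis
      unfolding right_annihilator_End_ring[OF f] principal_right_ideal_End_ring[OF assms(1) g]
      using that by simp
  qed
  show "ker M f = im M g"
  proof
    show "ker M f \<subseteq> im M g"
      by (rule ker_subset_im[OF assms(2) f g iffD1[OF same_images]])
    show "im M g \<subseteq> ker M f"
      by (rule iffD2[OF same_images[OF g] order_refl])
  qed
next
  assume "ker M f = im M g"
  then show "right_annihilator S f = g <#\<^bsub>S\<^esub> carrier S"
    by (simp add: right_annihilator_End_ring[OF f] principal_right_ideal_End_ring[OF assms(1) g])
qed

lemma centrally_morphic_iff_End_right_centrally_morphic:
  assumes "image_projective R M" "generates_its_kernels R M"
  shows "centrally_morphic R M \<longleftrightarrow> right_centrally_morphic S"
proof -
  have "im M f = ker M g \<and> ker M f = im M g \<longleftrightarrow>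
      right_annihilator S f = g <#\<^bsub>S\<^esub> carrier S \<and> f <#\<^bsub>S\<^esub> carrier S = right_annihilator S g"
    if "f \<in> carrier S" "g \<in> center S" for f g
    unfolding right_annihilator_eq_principal_iff[OF assms that(1) center_closed[OF that(2)]]
    unfolding eq_commute[of "f <#\<^bsub>S\<^esub> carrier S"]
      right_annihilator_eq_principal_iff[OF assms center_closed[OF that(2)] that(1)]
    by blast
  then show ?thesis
    unfolding centrally_morphic_def right_centrally_morphic_def
    by (intro ball_cong bex_cong refl)
qed

text \<open>The equation \<open>g = g x g\<close> makes \<open>x g\<close> a projection with kernel
  \<open>ker g\<close>. An endomorphism vanishing on that kernel therefore factors through
  \<open>g\<close>, and centrality of \<open>g\<close> turns this into an inclusion of images.\<close>

lemma im_subset_of_ker_subset: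
  assumes g: "g \<in> center S" and h: "h \<in> carrier S" and x: "x \<in> carrier S"
    and regular: "g = g \<otimes>\<^bsub>S\<^esub> x \<otimes>\<^bsub>S\<^esub> g" and ker: "ker M g \<subseteq> ker M h"
  shows "im M h \<subseteq> im M g"
proof
  fix n assume "n \<in> im M h"
  then obtain m where m: "m \<in> carrier M" and n: "n = h m" by blast
  note gS = center_closed[OF g]
  note closed = End_ring_apply_closed[where R = R and M = M]
  have xgm: "x (g m) \<in> carrier M" by (rule closed[OF x closed[OF gS m]])
  have gxg: "g (x (g m)) = g m"
  proof -
    have "g m = (g \<otimes>\<^bsub>S\<^esub> x \<otimes>\<^bsub>S\<^esub> g) m" by (rule fun_cong[OF regular])
    also have "\<dots> = g (x (g m))"
      by (simp only: End_ring_apply_mult[OF m] End_ring_apply_mult[OF closed[OF gS m]])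
    finally show ?thesis by (rule sym)
  qed
  define d where "d = m \<ominus>\<^bsub>M\<^esub> x (g m)"
  have d: "d \<in> carrier M" and m_eq: "m = d \<oplus>\<^bsub>M\<^esub> x (g m)"
    using m xgm by (simp_all add: d_def M.minus_eq M.a_assoc M.l_neg)
  have "g m = g d \<oplus>\<^bsub>M\<^esub> g m"
    using arg_cong[OF m_eq, of g] End_ring_apply_add[OF gS d xgm] unfolding gxg by (rule trans)
  then have "g d = \<zero>\<^bsub>M\<^esub>"
    using M.add.r_cancel_one'[OF closed[OF gS m] closed[OF gS d]] by (rule iffD1[rotated])
  then have hd: "h d = \<zero>\<^bsub>M\<^esub>"
    using ker d by (auto simp: ker_iff)
  have "h m = h d \<oplus>\<^bsub>M\<^esub> h (x (g m))"
    using arg_cong[OF m_eq, of h] End_ring_apply_add[OF h d xgm] by (rule trans)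
  also have "\<dots> = h (x (g m))"
    unfolding hd by (rule M.l_zero[OF closed[OF h xgm]])
  also have "\<dots> = g (h (x m))"
    using center_End_ring_apply[OF g x m] center_End_ring_apply[OF g h closed[OF x m]] by simp
  finally show "n \<in> im M g"
    unfolding n using closed[OF h closed[OF x m]] by (rule image_eqI)
qed

lemma centrally_morphic_iff_centrally_quasi_morphic:
  assumes "von_Neumann_regular (center_ring S)"
  shows "centrally_morphic R M \<longleftrightarrow> centrally_quasi_morphic R M"
proof
  assume "centrally_morphic R M"
  then show "centrally_quasi_morphic R M"
    unfolding centrally_morphic_def centrally_quasi_morphic_def by blast
next
  assume quasi: "centrally_quasi_morphic R M"
  show "centrally_morphic R M"
    unfolding centrally_morphic_def
  proof
    fix f assume f: "f \<in> carrier S"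
    obtain g h where g: "g \<in> center S" and h: "h \<in> center S"
      and im_f: "im M f = ker M g" and ker_f: "ker M f = im M h"
      using quasi f unfolding centrally_quasi_morphic_def by blast
    obtain x where x: "x \<in> center S" and regular: "g = g \<otimes>\<^bsub>S\<^esub> x \<otimes>\<^bsub>S\<^esub> g"
      using assms g unfolding von_Neumann_regular_def center_ring_def by auto
    have "im M g \<subseteq> ker M f"
      using central_im_subset_ker_swap[OF f g] im_f by blast
    moreover have "im M f \<subseteq> ker M h"
      using central_im_subset_ker_swap[OF f h] ker_f by blast
    then have "im M h \<subseteq> im M g"
      using im_subset_of_ker_subset[OF g center_closed[OF h] center_closed[OF x] regular] im_f
      by blast
    ultimately have "ker M f = im M g"
      using ker_f by blast
    with g im_f show "\<exists>g \<in> center S. im M f = ker M g \<and> ker M f = im M g"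
      by blast
  qed
qed

end

theorem proposition2p2:
  fixes R :: "('a, 'm) ring_scheme" and M :: "('a, 'b, 'n) rmodule_scheme"
  assumes "right_module R M"
    and "image_projective R M"
    and "generates_its_kernels R M"
    and "von_Neumann_regular (center_ring (End_ring R M))"
  shows "(centrally_morphic R M \<longleftrightarrow> centrally_quasi_morphic R M) \<and>
         (centrally_quasi_morphic R M \<longleftrightarrow> right_centrally_morphic (End_ring R M))"
  using right_module.centrally_morphic_iff_centrally_quasi_morphic[OF assms(1,4)]
    right_module.centrally_morphic_iff_End_right_centrally_morphic[OF assms(1-3)]
  by blast

end
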